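(* Let $n\ge 1$ be an integer. In the $n$-agent disk inspection problem (defined in the context), the optimal (minimum over all feasible trajectories of the $n$ agents) worst-case inspection cost equals $$ \begin{cases} 1+\sqrt{3}+\dfrac{2\pi}{n} -\dfrac{5\pi}{6}, & \text{if } n=1,2, \\[2mm] \dfrac{1}{\cos(\pi/n)}, & \text{if } n\geq 3. \end{cases} $$
   Context: Let $D$ be the closed unit disk centered at the origin $O$ of $\mathbb R^2$, with boundary points $\mathcal P_t=(\cos t,\sin t)$, $t\in[0,2\pi]$. An agent located at a point $A$ inspects a boundary point $P$ if no convex combination of $A$ and $P$ lies in the interior of $D$. In the $n$-agent disk inspection problem, $n$ unit-speed agents all start at $O$ and move freely in the plane (each agent follows a continuous path starting at $O$ that is $1$-Lipschitz in time). The inspection time $\mathrm{insp}(P)$ of a boundary point $P$ is the first time at which some agent is at a point that inspects $P$. A collection of trajectories is feasible if every boundary point is inspected; its worst-case inspection cost is $\sup_{P}\mathrm{insp}(P)$ over all boundary points $P$. *)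

theory Defs
  imports "HOL-Analysis.Analysis"
begin

definition disk :: "(real ^ 2) set" where
  "disk = cball 0 1"

definition bdpt :: "real \<Rightarrow> real ^ 2" where
  "bdpt \<theta> = vector [cos \<theta>, sin \<theta>]"

definition inspects :: "real ^ 2 \<Rightarrow> real ^ 2 \<Rightarrow> bool" where
  "inspects A P \<longleftrightarrow> closed_segment A P \<inter> interior disk = {}"

text \<open>
  In \<open>trajectories n x\<close>, the vector \<open>x i s\<close> is the position of agent \<open>i < n\<close> at time
  \<open>s \<ge> 0\<close>; the values of \<open>x\<close> at other arguments are irrelevant.  Every agent moves with
  speed at most one.
\<close>

definition trajectories :: "nat \<Rightarrow> (nat \<Rightarrow> real \<Rightarrow> real ^ 2) \<Rightarrow> bool" where
  "trajectories n x \<longleftrightarrow> (\<forall>i<n. x i 0 = 0 \<and> 1-lipschitz_on {0..} (x i))"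

definition insp_times :: "nat \<Rightarrow> (nat \<Rightarrow> real \<Rightarrow> real ^ 2) \<Rightarrow> real ^ 2 \<Rightarrow> real set" where
  "insp_times n x P = {s. 0 \<le> s \<and> (\<exists>i<n. inspects (x i s) P)}"

definition feasible :: "nat \<Rightarrow> (nat \<Rightarrow> real \<Rightarrow> real ^ 2) \<Rightarrow> bool" where
  "feasible n x \<longleftrightarrow>
     trajectories n x \<and> (\<forall>\<theta>\<in>{0..2 * pi}. insp_times n x (bdpt \<theta>) \<noteq> {})"

text \<open>
  Inspection times are extended reals because the supremum over the boundary points may be
  infinite even for feasible trajectories.  For feasible trajectories the infimum in \<open>insp\<close>
  is attained, so it really is the first time of inspection; see \<open>insp_first_time\<close> below.
\<close>

definition insp :: "nat \<Rightarrow> (nat \<Rightarrow> real \<Rightarrow> real ^ 2) \<Rightarrow> real ^ 2 \<Rightarrow> ereal" where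
  "insp n x P = (INF s\<in>insp_times n x P. ereal s)"

definition cost :: "nat \<Rightarrow> (nat \<Rightarrow> real \<Rightarrow> real ^ 2) \<Rightarrow> ereal" where
  "cost n x = (SUP \<theta>\<in>{0..2 * pi}. insp n x (bdpt \<theta>))"

definition is_optimal_cost :: "nat \<Rightarrow> ereal \<Rightarrow> bool" where
  "is_optimal_cost n c \<longleftrightarrow>
     (\<exists>x. feasible n x \<and> cost n x = c) \<and> (\<forall>x. feasible n x \<longrightarrow> c \<le> cost n x)"

lemma closed_inspects: "closed {A. inspects A P}"
proof -
  have eq: "{A. inspects A P} =
      (\<Inter>u\<in>{0..1}. {A. (1 - u) *\<^sub>R A + u *\<^sub>R P \<in> - interior disk})"
    unfolding inspects_def disjoint_iff by (fastforce simp: in_segment)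
  have "closed {A. (1 - u) *\<^sub>R A + u *\<^sub>R P \<in> - interior disk}" for u
  proof -
    have "closed ((\<lambda>A. (1 - u) *\<^sub>R A + u *\<^sub>R P) -` (- interior disk))"
      by (intro closed_vimage continuous_intros) (simp add: closed_Compl)
    then show ?thesis
      by (simp add: vimage_def)
  qed
  then show ?thesis
    unfolding eq by (intro closed_INT ballI) blast
qed

lemma closed_insp_times:
  assumes "trajectories n x"
  shows "closed (insp_times n x P)"
proof -
  have eq: "insp_times n x P = (\<Union>i\<in>{..<n}. {0..} \<inter> x i -` {A. inspects A P})"
    unfolding insp_times_def by auto
  have "closed ({0..} \<inter> x i -` {A. inspects A P})" if "i < n" for i
  proof -
    have "continuous_on {0..} (x i)"
      using assms that lipschitz_on_continuous_on unfolding trajectories_def by blast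
    then have "closed (x i -` {A. inspects A P} \<inter> {0..})"
      using closed_inspects continuous_on_closed_vimage[of "{0::real..}" "x i"] by blast
    then show ?thesis
      by (simp add: Int_commute)
  qed
  then show ?thesis
    unfolding eq by (intro closed_UN) auto
qed

lemma insp_first_time:
  assumes "feasible n x" and "\<theta> \<in> {0..2 * pi}"
  obtains s where "s \<in> insp_times n x (bdpt \<theta>)" and "insp n x (bdpt \<theta>) = ereal s"
    and "\<And>s'. s' \<in> insp_times n x (bdpt \<theta>) \<Longrightarrow> s \<le> s'"
proof -
  let ?T = "insp_times n x (bdpt \<theta>)"
  have ne: "?T \<noteq> {}" and cl: "closed ?T"
    using assms closed_insp_times unfolding feasible_def by auto
  have bb: "bdd_below ?T"
    by (rule bdd_belowI[of _ 0]) (simp add: insp_times_def)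
  have mem: "Inf ?T \<in> ?T"
    using closed_contains_Inf[OF ne bb cl] .
  have le: "Inf ?T \<le> s'" if "s' \<in> ?T" for s'
    using cInf_lower[OF that bb] .
  have "insp n x (bdpt \<theta>) = ereal (Inf ?T)"
    unfolding insp_def
  proof (rule antisym)
    show "(INF s\<in>?T. ereal s) \<le> ereal (Inf ?T)"
      using mem by (rule INF_lower)
    show "ereal (Inf ?T) \<le> (INF s\<in>?T. ereal s)"
      using le by (intro INF_greatest) simp
  qed
  with mem le show thesis
    using that by blast
qed

end

(*
  A point A inspects the boundary point at angle t iff A . (cos t, sin t) >= 1, so a point at
  distance 1 / cos a from the origin sees an arc of half-angle a.  By additivity of measure some
  agent sees measure at least 2 pi / n, so the lower bound concerns a single path.

  Let D(a, eta) be the cost of extending the visible arc on one side by eta, starting at a point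
  of half-angle a.  If a path visits viewpoints and finally has seen measure mu, then going
  backwards along the path one can discard all viewpoints but one: moving from x to y and then
  sweeping by eta costs at least D(a_x, eta + k), where k bounds the measure seen from y and not
  from x.  This is the Cauchy-Schwarz inequality applied to y - x and a suitable unit vector.
  Hence the path has length at least 1 / cos a + D(a, mu - 2 a) for some a, and minimising over a
  gives the claim: a = pi / 6 for mu >= pi, and a = mu / 2 (a straight segment) for mu <= 2 pi / 3.
*)
theory Submission imports Defs
begin

section \<open>Boundary points in polar form, the inspection criterion, arcs modulo a full
  turn\<close>

lemma inner_bdpt_bdpt: "bdpt a \<bullet> bdpt b = cos (a - b)"
  by (simp add: bdpt_def inner_vec_def sum_2 cos_diff)

lemma norm_bdpt [simp]: "norm (bdpt a) = 1"
  by (simp add: norm_eq_sqrt_inner inner_bdpt_bdpt)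

lemma bdpt_periodic [simp]: "bdpt (a + 2 * pi * of_int m) = bdpt a"
  by (simp add: bdpt_def cos_add sin_add)

lemma polar_form:
  obtains p where "y = norm y *\<^sub>R bdpt p"
proof (cases "y = 0")
  case True
  then show thesis using that by simp
next
  case False
  have n: "(norm y)\<^sup>2 = (y $ 1)\<^sup>2 + (y $ 2)\<^sup>2"
    unfolding power2_norm_eq_inner inner_vec_def sum_2 by (simp add: power2_eq_square)
  have "(y $ 1 / norm y)\<^sup>2 + (y $ 2 / norm y)\<^sup>2 = 1"
    using False by (simp add: power_divide n[symmetric] add_divide_distrib[symmetric])
  then obtain p where "y $ 1 / norm y = cos p" "y $ 2 / norm y = sin p"
    by (rule sincos_total_2pi) blast
  then have "y $ 1 = norm y * cos p" "y $ 2 = norm y * sin p"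
    using False by (metis nonzero_mult_div_cancel_left times_divide_eq_right norm_eq_zero)+
  then have "y = norm y *\<^sub>R bdpt p"
    by (simp add: vec_eq_iff forall_2 bdpt_def)
  then show thesis using that by blast
qed

text \<open>If \<open>A\<close> satisfies the inequality, the linear function
  \<open>z \<bullet> bdpt t\<close> is at least 1 on the whole segment, which therefore avoids the
  open disk. Otherwise the norm drops below 1 on leaving the boundary point towards
  \<open>A\<close>.\<close>

lemma inspects_bdpt_iff: "inspects A (bdpt t) \<longleftrightarrow> 1 \<le> A \<bullet> bdpt t"
proof
  let ?P = "bdpt t"
  have P1: "?P \<bullet> ?P = 1" by (simp add: inner_bdpt_bdpt)
  {
    assume le: "1 \<le> A \<bullet> ?P"
    have "1 \<le> norm z" if z: "z \<in> closed_segment A ?P" for z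
    proof -
      obtain u where u: "0 \<le> u" "u \<le> 1" "z = (1 - u) *\<^sub>R A + u *\<^sub>R ?P"
        using z unfolding in_segment by blast
      have "1 = (1 - u) * 1 + u" by simp
      also have "\<dots> \<le> (1 - u) * (A \<bullet> ?P) + u"
        using le u by (intro add_right_mono mult_left_mono) auto
      also have "\<dots> = z \<bullet> ?P" using u P1 by (simp add: inner_add_left)
      also have "\<dots> \<le> norm z" using norm_cauchy_schwarz[of z ?P] by simp
      finally show ?thesis .
    qed
    then show "inspects A ?P"
      unfolding inspects_def disk_def interior_cball by (auto simp: disjoint_iff not_less)
  }
  assume ins: "inspects A ?P"
  show "1 \<le> A \<bullet> ?P"
  proof (rule ccontr)
    assume "\<not> 1 \<le> A \<bullet> ?P"
    then have lt: "A \<bullet> ?P < 1" by simp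
    define c where "c = 1 - A \<bullet> ?P"
    define v where "v = A - ?P"
    have c: "c > 0" using lt by (simp add: c_def)
    have v: "v \<bullet> v > 0" using lt P1 by (auto simp: v_def)
    have vP: "v \<bullet> ?P = - c" using P1 by (simp add: v_def c_def inner_diff_left)
    \<comment> \<open>The squared norm at \<open>?P + u *\<^sub>R v\<close> is
      \<open>1 + u * (u * (v \<bullet> v) - 2 * c)\<close>. The bound
      \<open>c / (v \<bullet> v)\<close> makes it less than 1; the bound 1 keeps the point on the
      segment.\<close>
    define u where "u = min 1 (c / (v \<bullet> v))"
    have u: "0 < u" "u \<le> 1" "u * (v \<bullet> v) \<le> c"
      using c v by (auto simp: u_def min_def field_simps)
    define z where "z = ?P + u *\<^sub>R v"
    have z1: "z \<in> closed_segment ?P A"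
      unfolding in_segment z_def v_def
      by (rule exI[of _ u]) (use u in \<open>auto simp: algebra_simps\<close>)
    have "z \<bullet> z = 1 + u * (u * (v \<bullet> v) - 2 * c)"
      using P1 vP by (simp add: z_def inner_add_left inner_add_right inner_commute algebra_simps)
    also have "\<dots> < 1" using u c by (simp add: mult_pos_neg)
    finally have "norm z < 1" by (simp add: norm_eq_sqrt_inner)
    then show False
      using ins z1 unfolding inspects_def disk_def interior_cball
      by (auto simp: closed_segment_commute)
  qed
qed

text \<open>Shift the interval so that its left end lies in \<open>{0..<2 * pi}\<close>. Being at
  most a full turn long, it then wraps around at most once, which leaves two pieces of total length
  \<open>q - p\<close>.\<close>

lemma measure_subset_periodic_interval_le:
  assumes "p \<le> q" "q \<le> p + 2 * pi" "S \<in> sets lborel"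
    and S: "\<And>t. t \<in> S \<Longrightarrow> t \<in> {0..<2 * pi} \<and> (\<exists>m::int. p \<le> t + 2 * pi * m \<and> t + 2 * pi * m \<le> q)"
  shows "measure lborel S \<le> q - p"
proof -
  define k where "k = \<lfloor>p / (2 * pi)\<rfloor>"
  define p' where "p' = p - 2 * pi * k"
  define q' where "q' = q - 2 * pi * k"
  have "of_int k \<le> p / (2 * pi)" "p / (2 * pi) < of_int k + 1"
    unfolding k_def by linarith+
  then have p': "0 \<le> p'" "p' < 2 * pi"
    by (simp_all add: p'_def field_simps)
  have q': "p' \<le> q'" "q' \<le> p' + 2 * pi" "q' - p' = q - p"
    using assms by (simp_all add: p'_def q'_def)
  have sub: "S \<subseteq> {p'..min q' (2 * pi)} \<union> {0..max 0 (q' - 2 * pi)}"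
  proof
    fix t assume "t \<in> S"
    then obtain m :: int where t: "0 \<le> t" "t < 2 * pi"
      and m: "p \<le> t + 2 * pi * m" "t + 2 * pi * m \<le> q" using S by fastforce
    have j: "p' \<le> t + 2 * pi * of_int (m - k)" "t + 2 * pi * of_int (m - k) \<le> q'"
      using m by (simp_all add: p'_def q'_def algebra_simps)
    have "0 < 2 * pi * (of_int (m - k) + 1)"
      using j t p' by (simp add: algebra_simps)
    then have "-1 < m - k" by (simp add: zero_less_mult_iff)
    moreover have "0 < 2 * pi * (2 - of_int (m - k))"
      using j t p' q' by (simp add: algebra_simps)
    then have "m - k < 2" by (simp add: zero_less_mult_iff)
    ultimately consider "m - k = 0" | "m - k = 1" by linarith
    then show "t \<in> {p'..min q' (2 * pi)} \<union> {0..max 0 (q' - 2 * pi)}"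
    proof cases
      case 1
      then show ?thesis using j t unfolding 1 by auto
    next
      case 2
      then show ?thesis using j t unfolding 2 by auto
    qed
  qed
  have "measure lborel S \<le> measure lborel ({p'..min q' (2 * pi)} \<union> {0..max 0 (q' - 2 * pi)})"
  proof (rule measure_mono_fmeasurable[OF sub])
    show "S \<in> sets lborel" by fact
    show "{p'..min q' (2 * pi)} \<union> {0..max 0 (q' - 2 * pi)} \<in> fmeasurable lborel"
      by (intro fmeasurable.Un) (auto simp: fmeasurable_def emeasure_lborel_Icc_eq)
  qed
  also have "\<dots> \<le> measure lborel {p'..min q' (2 * pi)} + measure lborel {0..max 0 (q' - 2 * pi)}"
    by (rule measure_Un_le) auto
  also have "\<dots> = q - p" using p' q' by (auto simp: min_def max_def)
  finally show ?thesis .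
qed

section \<open>The cost of a one-sided sweep\<close>

text \<open>\<open>sweep_cost a \<eta>\<close> is the length that a path needs which starts at a point \<open>A\<close> at distance
  \<open>1 / cos a\<close> from the origin, which sees the arc of half-angle \<open>a\<close> around its direction, and extends
  this arc by \<open>\<eta>\<close> on one side: up to \<open>pi / 2\<close> it is the distance from \<open>A\<close> to the tangent line at angle
  \<open>a + \<eta>\<close>; beyond, the path runs along a tangent from \<open>A\<close> to the circle, follows the circle, and
  leaves it along a tangent of length 1.\<close>

definition sweep_cost :: "real \<Rightarrow> real \<Rightarrow> real" where
  "sweep_cost a \<eta> =
     (if \<eta> \<le> 0 then 0
      else if \<eta> \<le> pi / 2 then 1 - cos (a + \<eta>) / cos a
      else tan a + 1 + (\<eta> - pi / 2))"

lemma sweep_cost_near: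
  assumes "0 \<le> a" "a < pi / 2" "0 \<le> \<eta>" "\<eta> \<le> pi / 2"
  shows "sweep_cost a \<eta> = 1 - cos (a + \<eta>) / cos a"
proof -
  have "cos a > 0" using assms by (intro cos_gt_zero_pi) auto
  then show ?thesis using assms by (auto simp: sweep_cost_def)
qed

text \<open>The two formulas agree at \<open>pi / 2\<close>, since
  \<open>- cos (a + pi / 2) = sin a\<close>, so the far one also covers that endpoint.\<close>

lemma sweep_cost_far:
  assumes "pi / 2 \<le> \<eta>"
  shows "sweep_cost a \<eta> = tan a + 1 + (\<eta> - pi / 2)"
proof (cases "\<eta> = pi / 2")
  case True
  then show ?thesis
    unfolding True using not_le[THEN iffD2, OF pi_gt_zero]
    by (simp add: sweep_cost_def tan_def cos_add)
next
  case False
  moreover have "0 < \<eta>" using assms pi_half_gt_zero by linarith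
  ultimately show ?thesis using assms by (simp add: sweep_cost_def)
qed

lemma sweep_cost_mono:
  assumes a: "0 \<le> a" "a < pi / 2" and le: "\<eta> \<le> \<eta>'"
  shows "sweep_cost a \<eta> \<le> sweep_cost a \<eta>'"
proof -
  have c: "cos a > 0" using a by (intro cos_gt_zero_pi) auto
  have near: "sweep_cost a s \<le> sweep_cost a s'" if "0 \<le> s" "s \<le> s'" "s' \<le> pi / 2" for s s'
  proof -
    have "cos (a + s') \<le> cos (a + s)"
      using that a by (intro cos_monotone_0_pi_le) auto
    then show ?thesis using that a c by (simp add: sweep_cost_near divide_right_mono)
  qed
  have far: "sweep_cost a s \<le> sweep_cost a s'" if "pi / 2 \<le> s" "s \<le> s'" for s s'
    using that by (simp add: sweep_cost_far)
  have pos: "sweep_cost a s \<le> sweep_cost a s'" if "0 \<le> s" "s \<le> s'" for s s'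
    using near[of s s'] near[of s "pi/2"] far[of s s'] far[of "pi/2" s'] that by linarith
  have z: "sweep_cost a s = 0" if "s \<le> 0" for s using that by (simp add: sweep_cost_def)
  show ?thesis using pos[of \<eta> \<eta>'] pos[of 0 \<eta>'] z[of \<eta>] z[of \<eta>'] z[of 0] le by linarith
qed

text \<open>Within distance \<open>b\<close> of \<open>pi / 2\<close> the sine is at least
  \<open>cos b\<close>, so the cosine falls at least at that rate.\<close>

lemma cos_diff_ge_mult:
  assumes "0 \<le> b" "b < pi / 2" "pi / 2 - b \<le> s" "s \<le> s'" "s' \<le> pi / 2 + b"
  shows "cos b * (s' - s) \<le> cos s - cos s'"
proof -
  have "cos s' + cos b * s' \<le> cos s + cos b * s"
  proof (rule DERIV_nonpos_imp_nonincreasing[OF assms(4)])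
    fix x assume x: "s \<le> x" "x \<le> s'"
    have "cos b \<le> cos (x - pi / 2)"
      using cos_monotone_0_pi_le[of "\<bar>x - pi / 2\<bar>" b] x assms by (simp add: abs_le_iff)
    then have "cos b \<le> sin x" by (simp add: cos_diff)
    moreover have "((\<lambda>x. cos x + cos b * x) has_real_derivative (- sin x + cos b)) (at x)"
      by (auto intro!: derivative_eq_intros)
    ultimately show "\<exists>y. ((\<lambda>x. cos x + cos b * x) has_real_derivative y) (at x) \<and> y \<le> 0"
      by (intro exI[of _ "- sin x + cos b"]) auto
  qed
  then show ?thesis by (simp add: algebra_simps)
qed

text \<open>The left-hand side of hypothesis \<open>d\<close> is the component of the displacement from the point
  with polar coordinates \<open>(1 / cos a, 0)\<close> to the one with \<open>(1 / cos b, g)\<close> in direction \<open>\<phi>\<close>.\<close>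

lemma sweep_cost_step:
  assumes a: "0 \<le> a" "a < pi / 2" and b: "0 \<le> b" "b < pi / 2"
    and g: "g \<le> a + b" "a \<le> g + b"
    and d: "\<And>\<phi>. cos (\<phi> - g) / cos b - cos \<phi> / cos a \<le> d"
  shows "sweep_cost a (\<eta> + (g + b - a)) \<le> d + sweep_cost b \<eta>"
proof -
  have ca: "cos a > 0" and cb: "cos b > 0" using a b by (auto intro!: cos_gt_zero_pi)
  have near: "sweep_cost a (\<eta> + (g + b - a)) \<le> d + sweep_cost b \<eta>"
    if \<eta>: "0 \<le> \<eta>" "\<eta> \<le> pi / 2" for \<eta>
  proof (cases "\<eta> + (g + b - a) \<le> pi / 2")
    case True
    then have "sweep_cost a (\<eta> + (g + b - a)) = 1 - cos (g + b + \<eta>) / cos a"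
      using a g \<eta> by (simp add: sweep_cost_near algebra_simps)
    moreover have "sweep_cost b \<eta> = 1 - cos (b + \<eta>) / cos b"
      using b \<eta> by (simp add: sweep_cost_near)
    \<comment> \<open>Both sweeps end at the tangent line at angle \<open>g + b + \<eta>\<close>, so
      the displacement is tested in the direction normal to it.\<close>
    ultimately show ?thesis using d[of "g + b + \<eta>"] by simp
  next
    case False
    have 1: "sweep_cost a (\<eta> + (g + b - a)) = tan a + 1 + (\<eta> + (g + b - a) - pi / 2)"
      using False by (simp add: sweep_cost_far)
    have 2: "sweep_cost b \<eta> = 1 - cos (b + \<eta>) / cos b"
      using b \<eta> by (simp add: sweep_cost_near)
    \<comment> \<open>The test direction is now that of the tangent leg which starts the sweep from
      the first point. The arc that follows is paid for by \<open>cos_diff_ge_mult\<close>;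
      \<open>g \<le> a + b\<close> keeps both angles within \<open>b\<close> of
      \<open>pi / 2\<close>.\<close>
    have 3: "cos (a + pi / 2 - g) / cos b + tan a \<le> d"
      using d[of "a + pi / 2"] by (simp add: tan_def cos_add)
    have "cos b * ((b + \<eta>) - (a + pi / 2 - g)) \<le> cos (a + pi / 2 - g) - cos (b + \<eta>)"
      using b g \<eta> False by (intro cos_diff_ge_mult) auto
    then have "(b + \<eta>) - (a + pi / 2 - g) \<le> cos (a + pi / 2 - g) / cos b - cos (b + \<eta>) / cos b"
      using cb by (simp add: field_simps)
    then show ?thesis using 1 2 3 by linarith
  qed
  consider "\<eta> \<le> 0" | "0 \<le> \<eta>" "\<eta> \<le> pi / 2" | "pi / 2 \<le> \<eta>" by linarith
  then show ?thesis
  proof cases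
    case 1
    then have "sweep_cost a (\<eta> + (g + b - a)) \<le> sweep_cost a (0 + (g + b - a))"
      by (intro sweep_cost_mono a) auto
    also have "\<dots> \<le> d + sweep_cost b 0" by (rule near) auto
    also have "\<dots> = d + sweep_cost b \<eta>" using 1 by (simp add: sweep_cost_def)
    finally show ?thesis .
  next
    case 2
    then show ?thesis by (rule near)
  next
    case 3
    \<comment> \<open>Beyond \<open>pi / 2\<close> both sides grow with slope 1 in
      \<open>\<eta>\<close>.\<close>
    then show ?thesis using near[of "pi / 2"] g by (simp add: sweep_cost_far)
  qed
qed

text \<open>When the arcs touch, both points lie on the tangent at angle \<open>a\<close>, on
  opposite sides of the contact point at distances \<open>tan a\<close> and \<open>tan b\<close>;
  the displacement is their sum along this tangent.\<close>

lemma test_direction_touching_arcs: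
  assumes a: "0 \<le> a" "a < pi / 2" and b: "0 \<le> b" "b < pi / 2"
  shows "cos (\<phi> - (a + b)) / cos b - cos \<phi> / cos a \<le> tan a + tan b"
proof -
  have ca: "cos a > 0" and cb: "cos b > 0" using a b by (auto intro!: cos_gt_zero_pi)
  have "cos ((\<phi> - a) - b) / cos b = cos (\<phi> - a) + sin (\<phi> - a) * tan b"
    using cb by (simp only: cos_diff[of "\<phi> - a" b]) (simp add: tan_def field_simps)
  moreover have "cos ((\<phi> - a) + a) / cos a = cos (\<phi> - a) - sin (\<phi> - a) * tan a"
    using ca by (simp only: cos_add[of "\<phi> - a" a]) (simp add: tan_def field_simps)
  ultimately have "cos (\<phi> - (a + b)) / cos b - cos \<phi> / cos a = sin (\<phi> - a) * (tan a + tan b)"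
    by (simp add: algebra_simps)
  also have "\<dots> \<le> 1 * (tan a + tan b)"
  proof (rule mult_right_mono)
    have "0 \<le> tan a" "0 \<le> tan b" using a b by (auto simp: tan_pos_pi2_le)
    then show "0 \<le> tan a + tan b" by simp
  qed simp
  finally show ?thesis by simp
qed

section \<open>Minimising over the half-angle\<close>

text \<open>This is the part depending on \<open>a\<close> of the total cost when the sweep exceeds
  \<open>pi / 2\<close>. Its derivative is
  \<open>(1 + sin a) * (2 * sin a - 1) / (cos a * cos a)\<close>.\<close>

lemma sec_plus_tan_ge:
  assumes a: "0 \<le> a" "a < pi / 2"
  shows "sqrt 3 - pi / 3 \<le> 1 / cos a + tan a - 2 * a"
proof -
  let ?f = "\<lambda>a::real. (1 + sin a) / cos a - 2 * a"
  have c: "cos x > 0" if "0 \<le> x" "x < pi / 2" for x using that by (intro cos_gt_zero_pi) auto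
  have D: "(?f has_real_derivative ((cos x * cos x + (1 + sin x) * sin x) / (cos x * cos x) - 2)) (at x)"
    if "0 \<le> x" "x < pi / 2" for x
    using c[OF that] by (auto intro!: derivative_eq_intros simp: field_simps)
  have num: "cos x * cos x + (1 + sin x) * sin x = 1 + sin x" for x :: real
    using sin_cos_squared_add[of x] by (simp add: algebra_simps power2_eq_square)
  have E: "(cos x * cos x + (1 + sin x) * sin x) / (cos x * cos x) - 2
      = (1 + sin x) * (2 * sin x - 1) / (cos x * cos x)" if "0 \<le> x" "x < pi / 2" for x
  proof -
    have "cos x * cos x = 1 - sin x * sin x"
      using sin_cos_squared_add[of x] unfolding power2_eq_square by linarith
    then have "1 + sin x - 2 * (cos x * cos x) = (1 + sin x) * (2 * sin x - 1)"
      unfolding ring_distribs by linarith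
    moreover have "(1 + sin x) / (cos x * cos x) - 2 = (1 + sin x - 2 * (cos x * cos x)) / (cos x * cos x)"
      using c[OF that] by (simp add: diff_divide_distrib)
    ultimately show ?thesis unfolding num by (simp only:)
  qed
  have s0: "0 \<le> sin x" if "0 \<le> x" "x < pi / 2" for x using that by (intro sin_ge_zero) auto
  \<comment> \<open>The minimum is where \<open>sin a = 1 / 2\<close>.\<close>
  have "?f (pi / 6) \<le> ?f a"
  proof (cases "a \<le> pi / 6")
    case True
    show ?thesis
    proof (rule DERIV_nonpos_imp_nonincreasing[OF True])
      fix x assume x: "a \<le> x" "x \<le> pi / 6"
      then have xx: "0 \<le> x" "x < pi / 2" using a by auto
      have "sin x \<le> sin (pi / 6)" using x xx by (intro sin_monotone_2pi_le) auto
      then have "(1 + sin x) * (2 * sin x - 1) / (cos x * cos x) \<le> 0"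
        using s0[OF xx] c[OF xx]
        by (intro divide_nonpos_pos mult_nonneg_nonpos) (auto simp: sin_30)
      then show "\<exists>y. (?f has_real_derivative y) (at x) \<and> y \<le> 0"
        using D[OF xx] E[OF xx] by auto
    qed
  next
    case False
    show ?thesis
    proof (rule DERIV_nonneg_imp_nondecreasing[of "pi / 6" a])
      show "pi / 6 \<le> a" using False by simp
    next
      fix x assume x: "pi / 6 \<le> x" "x \<le> a"
      have "0 \<le> pi / 6" by simp
      then have xx: "0 \<le> x" "x < pi / 2" using a x by linarith+
      have "sin (pi / 6) \<le> sin x" using x xx by (intro sin_monotone_2pi_le) auto
      then have "0 \<le> (1 + sin x) * (2 * sin x - 1) / (cos x * cos x)"
        using s0[OF xx] c[OF xx]
        by (intro divide_nonneg_pos mult_nonneg_nonneg) (auto simp: sin_30)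
      then show "\<exists>y. (?f has_real_derivative y) (at x) \<and> 0 \<le> y"
        using D[OF xx] E[OF xx] by auto
    qed
  qed
  moreover have "?f (pi / 6) = sqrt 3 - pi / 3"
    by (simp add: sin_30 cos_30 field_simps)
  ultimately show ?thesis by (simp add: tan_def add_divide_distrib)
qed

text \<open>The sweep exceeds \<open>pi / 2\<close> except when \<open>\<mu> = pi\<close> and
  \<open>a > pi / 4\<close>. There it costs exactly 2, and \<open>1 / cos a \<ge> sqrt 2\<close>
  suffices numerically.\<close>

lemma sec_plus_sweep_cost_ge_wide:
  assumes a: "0 \<le> a" "a < pi / 2" and \<mu>: "\<mu> = pi \<or> \<mu> = 2 * pi"
  shows "1 + sqrt 3 + \<mu> - 5 * pi / 6 \<le> 1 / cos a + sweep_cost a (\<mu> - 2 * a)"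
proof (cases "pi / 2 \<le> \<mu> - 2 * a")
  case True
  then show ?thesis using sec_plus_tan_ge[OF a] by (simp add: sweep_cost_far)
next
  case False
  then have \<mu>pi: "\<mu> = pi" and a4: "pi / 4 < a" using \<mu> a by auto
  have c: "0 < cos a" using a by (intro cos_gt_zero_pi) auto
  have "sweep_cost a (\<mu> - 2 * a) = 1 - cos (pi - a) / cos a"
    using a False by (simp add: sweep_cost_near \<mu>pi)
  then have s: "sweep_cost a (\<mu> - 2 * a) = 2" using c by simp
  have "cos a \<le> cos (pi / 4)" using a4 a by (intro cos_monotone_0_pi_le) auto
  then have "1 / cos (pi / 4) \<le> 1 / cos a" using c by (intro divide_left_mono) (auto simp: cos_45)
  then have "sqrt 2 \<le> 1 / cos a" by (simp add: cos_45 real_div_sqrt)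
  moreover have "1.4 \<le> sqrt 2" by (rule real_le_rsqrt) (simp add: power2_eq_square)
  moreover have "sqrt 3 \<le> 1.75" by (rule real_le_lsqrt) (auto simp: power2_eq_square)
  moreover have "pi < 3.2" using pi_approx by simp
  ultimately show ?thesis using s \<mu>pi by simp
qed

text \<open>The bound \<open>h \<le> pi / 3\<close> enters as \<open>1 \<le> 2 * cos h\<close>: it
  makes walking straight on to half-angle \<open>h\<close> no worse than stopping at a smaller
  \<open>a\<close> and sweeping.\<close>

lemma sec_plus_sweep_cost_ge_narrow:
  assumes a: "0 \<le> a" "a < pi / 2" and h: "0 < h" "h \<le> pi / 3"
  shows "1 / cos h \<le> 1 / cos a + sweep_cost a (2 * h - 2 * a)"
proof -
  have ca: "0 < cos a" using a by (intro cos_gt_zero_pi) auto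
  have ch: "0 < cos h" using h by (intro cos_gt_zero_pi) auto
  consider "h \<le> a" | "a < h" "2 * h - 2 * a \<le> pi / 2" | "pi / 2 < 2 * h - 2 * a" by linarith
  then show ?thesis
  proof cases
    case 1
    then have "cos a \<le> cos h" using h a by (intro cos_monotone_0_pi_le) auto
    then show ?thesis using 1 ca ch by (simp add: sweep_cost_def field_simps)
  next
    case 2
    have s: "sweep_cost a (2 * h - 2 * a) = 1 - cos (2 * h - a) / cos a"
      using a 2 by (simp add: sweep_cost_near algebra_simps)
    \<comment> \<open>Around the midpoint \<open>h\<close> of \<open>a\<close> and
      \<open>2 * h - a\<close>, the claim without denominators splits into
      \<open>cos h * cos e \<le> cos h\<close> and
      \<open>sin h * sin e \<le> 2 * cos h * sin h * sin e\<close>.\<close>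
    define e where "e = h - a"
    have e: "0 < e" "e \<le> pi" using 2 a h by (auto simp: e_def)
    have se: "0 \<le> sin e" using e by (intro sin_ge_zero) auto
    have cosa: "cos a = cos h * cos e + sin h * sin e"
      using cos_diff[of h e] by (simp add: e_def)
    have cos2: "cos (2 * h - a) = cos h * cos e - sin h * sin e"
      using cos_add[of h e] by (simp add: e_def)
    have "cos (pi / 3) \<le> cos h" using h by (intro cos_monotone_0_pi_le) auto
    then have "1 \<le> 2 * cos h" by (simp add: cos_60)
    then have "sin h * 1 \<le> sin h * (2 * cos h)"
      using h by (intro mult_left_mono sin_ge_zero) auto
    then have "sin h * sin e \<le> sin h * (2 * cos h) * sin e"
      using se by (intro mult_right_mono) auto
    moreover have "cos h * cos e \<le> cos h * 1" using ch by (intro mult_left_mono) auto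
    ultimately have "cos a \<le> cos h - cos h * cos (2 * h - a) + cos h * cos a"
      unfolding cosa cos2 by (simp add: algebra_simps)
    then have "1 / cos h \<le> (1 - cos (2 * h - a) + cos a) / cos a"
      using ca ch by (simp add: field_simps)
    also have "\<dots> = 1 / cos a + (1 - cos (2 * h - a) / cos a)"
      using ca by (simp add: field_simps)
    finally show ?thesis by (simp only: s)
  next
    case 3
    have "cos (pi / 3) \<le> cos h" using h by (intro cos_monotone_0_pi_le) auto
    then have "1 / cos h \<le> 2" using ch by (simp add: cos_60 field_simps)
    moreover have "1 \<le> 1 / cos a" using ca by simp
    moreover have "0 \<le> tan a" using a by (simp add: tan_pos_pi2_le)
    ultimately show ?thesis using 3 by (simp add: sweep_cost_far)
  qed
qed

section \<open>What finitely many viewpoints see\<close>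

definition visible :: "real ^ 2 \<Rightarrow> real set" where
  "visible y = {t \<in> {0..<2 * pi}. 1 \<le> y \<bullet> bdpt t}"

definition half_angle :: "real ^ 2 \<Rightarrow> real" where
  "half_angle y = arccos (1 / norm y)"

lemma half_angle_bounds:
  assumes "1 \<le> norm y"
  shows "0 \<le> half_angle y" "half_angle y < pi / 2" "cos (half_angle y) = 1 / norm y"
proof -
  have "0 < norm y" using assms by linarith
  then have n: "0 < 1 / norm y" "1 / norm y \<le> 1" using assms by (simp_all add: field_simps)
  then have n': "-1 \<le> 1 / norm y" by linarith
  show "0 \<le> half_angle y" "cos (half_angle y) = 1 / norm y"
    using n n' by (auto simp: half_angle_def arccos_lbound cos_arccos)
  have "arccos (1 / norm y) < arccos 0" using n by (intro arccos_less_arccos) auto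
  then show "half_angle y < pi / 2" by (simp add: half_angle_def)
qed

lemma exists_shift_abs_le_pi:
  fixes s :: real
  obtains m :: int where "\<bar>s + 2 * pi * m\<bar> \<le> pi"
proof -
  have "\<bar>of_int (round (s / (2 * pi))) - s / (2 * pi)\<bar> \<le> 1 / 2"
    by (rule of_int_round_abs_le)
  then have "\<bar>of_int (round (s / (2 * pi))) - s / (2 * pi)\<bar> * (2 * pi) \<le> 1 / 2 * (2 * pi)"
    by (intro mult_right_mono) auto
  also have "\<bar>of_int (round (s / (2 * pi))) - s / (2 * pi)\<bar> * (2 * pi)
      = \<bar>(of_int (round (s / (2 * pi))) - s / (2 * pi)) * (2 * pi)\<bar>"
    by (simp add: abs_mult)
  also have "(of_int (round (s / (2 * pi))) - s / (2 * pi)) * (2 * pi)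
      = 2 * pi * of_int (round (s / (2 * pi))) - s"
    by (simp add: left_diff_distrib)
  finally have "\<bar>s + 2 * pi * of_int (- round (s / (2 * pi)))\<bar> \<le> pi"
    by (simp add: abs_minus_commute)
  then show thesis by (rule that)
qed

lemma cos_le_cos_iff_shift:
  assumes "0 \<le> a" "a \<le> pi"
  shows "cos a \<le> cos s \<longleftrightarrow> (\<exists>m::int. \<bar>s + 2 * pi * m\<bar> \<le> a)"
proof -
  have per: "cos (s + 2 * pi * of_int m) = cos s" for m :: int
    by (simp add: cos_add)
  show ?thesis
  proof
    assume le: "cos a \<le> cos s"
    obtain m :: int where m: "\<bar>s + 2 * pi * m\<bar> \<le> pi" by (rule exists_shift_abs_le_pi)
    have "cos a \<le> cos \<bar>s + 2 * pi * m\<bar>" using le per[of m] by simp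
    then have "\<bar>s + 2 * pi * m\<bar> \<le> a" using m assms by (subst (asm) cos_mono_le_eq) auto
    then show "\<exists>m::int. \<bar>s + 2 * pi * m\<bar> \<le> a" ..
  next
    assume "\<exists>m::int. \<bar>s + 2 * pi * m\<bar> \<le> a"
    then obtain m :: int where m: "\<bar>s + 2 * pi * m\<bar> \<le> a" ..
    have "cos a \<le> cos \<bar>s + 2 * pi * m\<bar>" using m assms by (intro cos_monotone_0_pi_le) auto
    then show "cos a \<le> cos s" using per[of m] by simp
  qed
qed

lemma mem_visible_polar_iff:
  assumes "1 \<le> norm y" "y = norm y *\<^sub>R bdpt p"
  shows "t \<in> visible y \<longleftrightarrow> t \<in> {0..<2 * pi} \<and> (\<exists>m::int. \<bar>t - p + 2 * pi * m\<bar> \<le> half_angle y)"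
proof -
  have "y \<bullet> bdpt t = norm y * cos (t - p)"
    by (subst assms(2)) (simp add: inner_bdpt_bdpt cos_diff mult.commute)
  moreover have "1 \<le> norm y * c \<longleftrightarrow> 1 / norm y \<le> c" for c
    using assms(1) by (subst pos_divide_le_eq) (auto simp: mult.commute)
  ultimately have "1 \<le> y \<bullet> bdpt t \<longleftrightarrow> cos (half_angle y) \<le> cos (t - p)"
    using half_angle_bounds[OF assms(1)] by simp
  then show ?thesis
    unfolding visible_def
    using cos_le_cos_iff_shift[of "half_angle y" "t - p"] half_angle_bounds[OF assms(1)] by auto
qed

lemma norm_ge_1_if_visible:
  assumes "t \<in> visible y"
  shows "1 \<le> norm y"
  using assms norm_cauchy_schwarz[of y "bdpt t"] by (simp add: visible_def)

lemma continuous_on_bdpt: "continuous_on S bdpt"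
proof -
  have "bdpt = (\<lambda>t. \<chi> i. if i = 1 then cos t else sin t)"
    by (simp add: fun_eq_iff bdpt_def vec_eq_iff forall_2)
  moreover have "continuous_on S (\<lambda>t::real. (\<chi> i. if i = 1 then cos t else sin t) :: real ^ 2)"
  proof (intro continuous_on_vec_lambda)
    show "continuous_on S (\<lambda>t. if i = 1 then cos t else sin t)" for i :: 2
      by (cases "i = 1") (auto intro!: continuous_intros)
  qed
  ultimately show ?thesis by (simp only:)
qed

lemma sets_visible [measurable, simp]: "visible y \<in> sets borel"
proof -
  have "closed {t. 1 \<le> y \<bullet> bdpt t}"
    by (intro closed_Collect_le continuous_intros continuous_on_bdpt)
  moreover have "visible y = {0..<2 * pi} \<inter> {t. 1 \<le> y \<bullet> bdpt t}"
    by (auto simp: visible_def)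
  ultimately show ?thesis by (auto intro: borel_closed)
qed

lemma visible_subset: "visible y \<subseteq> {0..<2 * pi}"
  by (auto simp: visible_def)

lemma fmeasurable_subset_circle:
  assumes "S \<in> sets lborel" "S \<subseteq> {0..<2 * pi}"
  shows "S \<in> fmeasurable lborel"
proof (rule fmeasurableI2[OF _ assms(2,1)])
  show "{0..<2 * pi} \<in> fmeasurable lborel"
    by (simp add: fmeasurable_def emeasure_lborel_Ico)
qed

lemma measure_visible_le:
  assumes "1 \<le> norm y"
  shows "measure lborel (visible y) \<le> 2 * half_angle y"
proof -
  obtain p where p: "y = norm y *\<^sub>R bdpt p" by (rule polar_form)
  have "measure lborel (visible y) \<le> (p + half_angle y) - (p - half_angle y)"
  proof (rule measure_subset_periodic_interval_le)
    fix t assume "t \<in> visible y"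
    then obtain m :: int where t: "t \<in> {0..<2 * pi}" and m: "\<bar>t - p + 2 * pi * m\<bar> \<le> half_angle y"
      using mem_visible_polar_iff[OF assms p] by blast
    show "t \<in> {0..<2 * pi} \<and>
        (\<exists>m::int. p - half_angle y \<le> t + 2 * pi * m \<and> t + 2 * pi * m \<le> p + half_angle y)"
      using t m by (intro conjI exI[of _ m]) auto
  qed (use half_angle_bounds[OF assms] in auto)
  then show ?thesis by simp
qed

text \<open>Two viewpoints neither of which sees everything the other sees: moving from \<open>x\<close> to \<open>y\<close> reveals
  measure at most \<open>k\<close>, and cannot be cheaper than a one-sided sweep from \<open>x\<close> by the amount \<open>k\<close>.\<close>

lemma visible_step:
  assumes x: "1 \<le> norm x" and y: "1 \<le> norm y"
    and nyx: "\<not> visible y \<subseteq> visible x" and nxy: "\<not> visible x \<subseteq> visible y"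
  obtains k where "measure lborel (visible y - visible x) \<le> k"
    and "\<And>\<eta>. sweep_cost (half_angle x) (\<eta> + k) \<le> dist x y + sweep_cost (half_angle y) \<eta>"
proof -
  define a b where "a = half_angle x" and "b = half_angle y"
  note ab = half_angle_bounds[OF x, folded a_def] half_angle_bounds[OF y, folded b_def]
  obtain p where p: "x = norm x *\<^sub>R bdpt p" by (rule polar_form)
  obtain q0 where q0: "y = norm y *\<^sub>R bdpt q0" by (rule polar_form)
  obtain m0 :: int where m0: "\<bar>q0 - p + 2 * pi * m0\<bar> \<le> pi" by (rule exists_shift_abs_le_pi)
  define q where "q = q0 + 2 * pi * m0"
  have q: "y = norm y *\<^sub>R bdpt q" using q0 by (simp add: q_def)
  define g where "g = \<bar>q - p\<bar>"
  \<comment> \<open>Angles multiplied by \<open>\<sigma>\<close> are counted from \<open>x\<close>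
    towards \<open>y\<close>, which treats both orientations at once.\<close>
  define \<sigma> :: real where "\<sigma> = (if p \<le> q then 1 else -1)"
  have \<sigma>: "\<sigma> = 1 \<or> \<sigma> = -1" "q = p + \<sigma> * g" by (auto simp: \<sigma>_def g_def)
  have g: "0 \<le> g" "g \<le> pi" using m0 by (auto simp: g_def q_def algebra_simps)
  note vx = mem_visible_polar_iff[OF x p, folded a_def]
  note vy = mem_visible_polar_iff[OF y q, folded b_def]
  \<comment> \<open>If the centres were at most \<open>a - b\<close> apart, the arc of
    \<open>y\<close> would lie inside that of \<open>x\<close>; \<open>ga\<close> is the mirror
    image.\<close>
  have gb: "a < g + b"
  proof (rule ccontr)
    assume c: "\<not> a < g + b"
    have "visible y \<subseteq> visible x"
    proof
      fix t assume "t \<in> visible y"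
      then obtain m :: int where t: "t \<in> {0..<2 * pi}" and m: "\<bar>t - q + 2 * pi * m\<bar> \<le> b"
        using vy by blast
      have "\<bar>t - p + 2 * pi * m\<bar> \<le> a" using m c by (auto simp: g_def)
      then show "t \<in> visible x" using vx t by blast
    qed
    then show False using nyx by simp
  qed
  have ga: "b < g + a"
  proof (rule ccontr)
    assume c: "\<not> b < g + a"
    have "visible x \<subseteq> visible y"
    proof
      fix t assume "t \<in> visible x"
      then obtain m :: int where t: "t \<in> {0..<2 * pi}" and m: "\<bar>t - p + 2 * pi * m\<bar> \<le> a"
        using vx by blast
      have "\<bar>t - q + 2 * pi * m\<bar> \<le> b" using m c by (auto simp: g_def)
      then show "t \<in> visible y" using vy t by blast
    qed
    then show False using nxy by simp
  qed
  show thesis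
  proof (cases "g \<le> a + b")
    case True
    show thesis
    proof (rule that)
      \<comment> \<open>By \<open>ga\<close> the arc of \<open>y\<close> does not stick out on the
        far side of \<open>x\<close>, so its new part lies in a single interval.\<close>
      have out: "a \<le> \<sigma> * (t - p + 2 * pi * m) \<and> \<sigma> * (t - p + 2 * pi * m) \<le> g + b"
        if "t \<in> {0..<2 * pi}" "\<bar>t - q + 2 * pi * m\<bar> \<le> b" "t \<notin> visible x" for t and m :: int
      proof -
        have "a < \<bar>t - p + 2 * pi * m\<bar>" using that vx[of t] by (meson not_le)
        then show ?thesis using that(2) \<sigma> True ga by (auto simp: abs_if split: if_splits)
      qed
      show "measure lborel (visible y - visible x) \<le> g + b - a"
      proof (cases "\<sigma> = 1")
        case True
        have "measure lborel (visible y - visible x) \<le> (p + g + b) - (p + a)"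
        proof (rule measure_subset_periodic_interval_le)
          fix t assume "t \<in> visible y - visible x"
          then obtain m :: int where t: "t \<in> {0..<2 * pi}" "\<bar>t - q + 2 * pi * m\<bar> \<le> b" "t \<notin> visible x"
            using vy by blast
          show "t \<in> {0..<2 * pi} \<and> (\<exists>m::int. p + a \<le> t + 2 * pi * m \<and> t + 2 * pi * m \<le> p + g + b)"
            using t(1) out[OF t] True by (intro conjI exI[of _ m]) auto
        qed (use gb g ab in auto)
        then show ?thesis by simp
      next
        case False
        then have s: "\<sigma> = -1" using \<sigma> by simp
        have "measure lborel (visible y - visible x) \<le> (p - a) - (p - g - b)"
        proof (rule measure_subset_periodic_interval_le)
          fix t assume "t \<in> visible y - visible x"
          then obtain m :: int where t: "t \<in> {0..<2 * pi}" "\<bar>t - q + 2 * pi * m\<bar> \<le> b" "t \<notin> visible x"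
            using vy by blast
          show "t \<in> {0..<2 * pi} \<and> (\<exists>m::int. p - g - b \<le> t + 2 * pi * m \<and> t + 2 * pi * m \<le> p - a)"
            using t(1) out[OF t] s by (intro conjI exI[of _ m]) auto
        qed (use gb g ab in auto)
        then show ?thesis by simp
      qed
    next
      fix \<eta>
      show "sweep_cost (half_angle x) (\<eta> + (g + b - a)) \<le> dist x y + sweep_cost (half_angle y) \<eta>"
        unfolding a_def[symmetric] b_def[symmetric]
      proof (rule sweep_cost_step)
        fix \<phi>
        \<comment> \<open>The unit vector at angle \<open>\<phi>\<close> from \<open>x\<close>
          towards \<open>y\<close>; Cauchy-Schwarz with \<open>y - x\<close> yields the hypothesis
          \<open>d\<close> of \<open>sweep_cost_step\<close>.\<close>
        let ?u = "bdpt (p + \<sigma> * \<phi>)"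
        have "y \<bullet> ?u = norm y * cos (\<phi> - g)"
        proof -
          have "q - (p + \<sigma> * \<phi>) = - (\<sigma> * (\<phi> - g))" using \<sigma> by (simp add: algebra_simps)
          then have "cos (q - (p + \<sigma> * \<phi>)) = cos (\<phi> - g)" using \<sigma>(1) by (auto simp: cos_diff)
          then show ?thesis by (subst q) (simp add: inner_bdpt_bdpt)
        qed
        moreover have "x \<bullet> ?u = norm x * cos \<phi>"
          using \<sigma>(1) by (subst p) (auto simp: inner_bdpt_bdpt)
        moreover have "(y - x) \<bullet> ?u \<le> dist x y"
          using norm_cauchy_schwarz[of "y - x" ?u] by (simp add: dist_norm norm_minus_commute)
        ultimately show "cos (\<phi> - g) / cos b - cos \<phi> / cos a \<le> dist x y"
          using ab by (simp add: inner_diff_left mult.commute)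
      qed (use ab True gb in auto)
    qed
  next
    \<comment> \<open>Disjoint arcs: the distance is at least the one for touching arcs, \<open>g = a + b\<close>.\<close>
    case False
    show thesis
    proof (rule that)
      have "measure lborel (visible y - visible x) \<le> measure lborel (visible y)"
        by (intro measure_mono_fmeasurable fmeasurable_subset_circle visible_subset) auto
      also have "\<dots> \<le> 2 * b" using measure_visible_le[OF y] by (simp add: b_def)
      finally show "measure lborel (visible y - visible x) \<le> 2 * b" .
      have ca: "cos a > 0" and cb: "cos b > 0" using ab(1,2,4,5) by (auto intro!: cos_gt_zero_pi)
      have nx: "norm x = 1 / cos a" and ny: "norm y = 1 / cos b" using ab by simp_all
      have d2: "(dist x y)\<^sup>2 = (norm x)\<^sup>2 + (norm y)\<^sup>2 - 2 * (norm x * norm y * cos g)"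
      proof -
        have "x \<bullet> y = norm x * norm y * cos g"
          using \<sigma> by (subst p, subst q) (auto simp: inner_bdpt_bdpt)
        then show ?thesis
          by (simp add: dist_norm power2_norm_eq_inner inner_diff_left inner_diff_right inner_commute)
      qed
      have "cos g \<le> cos (a + b)" using False ab g by (intro cos_monotone_0_pi_le) auto
      then have "norm x * norm y * cos g \<le> norm x * norm y * cos (a + b)"
        by (intro mult_left_mono) auto
      \<comment> \<open>Since the norms are secants, the law of cosines then gives the lower bound
        \<open>(tan a + tan b)\<^sup>2\<close>.\<close>
      also have "\<dots> = 1 - tan a * tan b"
        using ca cb unfolding nx ny by (simp add: cos_add tan_def field_simps)
      finally have "(norm x)\<^sup>2 + (norm y)\<^sup>2 - 2 * (1 - tan a * tan b) \<le> (dist x y)\<^sup>2"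
        unfolding d2 by (intro diff_left_mono mult_left_mono) simp_all
      moreover have "(norm x)\<^sup>2 = 1 + (tan a)\<^sup>2" "(norm y)\<^sup>2 = 1 + (tan b)\<^sup>2"
        unfolding nx ny using ca cb tan_sec[of a] tan_sec[of b]
        by (simp_all add: inverse_eq_divide power_one_over)
      ultimately have "(tan a + tan b)\<^sup>2 \<le> (dist x y)\<^sup>2"
        by (simp add: power2_sum)
      then have d: "tan a + tan b \<le> dist x y" by (rule power2_le_imp_le) simp
      fix \<eta>
      \<comment> \<open>For \<open>g = a + b\<close> the gain \<open>g + b - a\<close> is
        \<open>2 * b\<close>, all that \<open>y\<close> can see.\<close>
      have "sweep_cost a (\<eta> + ((a + b) + b - a)) \<le> (tan a + tan b) + sweep_cost b \<eta>"
        by (rule sweep_cost_step) (use ab test_direction_touching_arcs[of a b] in auto)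
      then show "sweep_cost (half_angle x) (\<eta> + 2 * b) \<le> dist x y + sweep_cost (half_angle y) \<eta>"
        using d by (simp add: a_def b_def)
    qed
  qed
qed

section \<open>Reducing a path to a single viewpoint\<close>

fun path_length :: "'a::metric_space list \<Rightarrow> real" where
  "path_length (x # y # zs) = dist x y + path_length (y # zs)"
| "path_length _ = 0"

text \<open>\<open>S\<close> is what has been seen before. Induction replaces the tail after
  \<open>x\<close> by one viewpoint \<open>y\<close> and a sweep; then either \<open>x\<close> is
  skipped by the triangle inequality, or \<open>visible_step\<close> absorbs \<open>y\<close> into a
  sweep from \<open>x\<close>. That \<open>y\<close> sees something outside \<open>S\<close> is
  carried along because \<open>visible_step\<close> needs it.\<close>

lemma path_length_ge_sweep:
  assumes "S \<in> sets lborel" "S \<subseteq> {0..<2 * pi}" "measure lborel S < \<mu>"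
    and "\<mu> \<le> measure lborel (S \<union> (\<Union>x\<in>set xs. visible x))"
  shows "\<exists>y. 1 \<le> norm y \<and> \<not> visible y \<subseteq> S \<and>
    dist x0 y + sweep_cost (half_angle y) (\<mu> - measure lborel (S \<union> visible y)) \<le> path_length (x0 # xs)"
  using assms
proof (induction xs arbitrary: x0 S)
  case Nil
  then show ?case by simp
next
  case (Cons x xs)
  define S' where "S' = S \<union> visible x"
  have S': "S' \<in> sets lborel" "S' \<subseteq> {0..<2 * pi}"
    using Cons.prems visible_subset by (auto simp: S'_def)
  have all: "S \<union> (\<Union>z\<in>set (x # xs). visible z) = S' \<union> (\<Union>z\<in>set xs. visible z)"
    by (auto simp: S'_def)
  show ?case
  proof (cases "visible x \<subseteq> S")
    case True
    then have "S' = S" by (auto simp: S'_def)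
    then obtain y where y: "1 \<le> norm y" "\<not> visible y \<subseteq> S"
      "dist x y + sweep_cost (half_angle y) (\<mu> - measure lborel (S \<union> visible y)) \<le> path_length (x # xs)"
      using Cons.IH[of S x] Cons.prems all by auto
    then show ?thesis using dist_triangle[of x0 y x] by (intro exI[of _ y]) (auto simp: dist_commute)
  next
    case new: False
    then have x: "1 \<le> norm x" using norm_ge_1_if_visible by blast
    show ?thesis
    proof (cases "\<mu> \<le> measure lborel S'")
      case True
      have "0 \<le> path_length zs" for zs :: "(real ^ 2) list"
        by (induction zs rule: path_length.induct) auto
      \<comment> \<open>Nothing is missing after \<open>x\<close>, so the sweep from
        \<open>x\<close> costs 0.\<close>
      then show ?thesis
        using True x new by (intro exI[of _ x]) (auto simp: S'_def sweep_cost_def)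
    next
      case False
      then obtain y where y: "1 \<le> norm y" "\<not> visible y \<subseteq> S'"
        "dist x y + sweep_cost (half_angle y) (\<mu> - measure lborel (S' \<union> visible y)) \<le> path_length (x # xs)"
        using Cons.IH[of S' x] Cons.prems S' all by auto
      show ?thesis
      proof (cases "visible x \<subseteq> visible y")
        case True
        then have "S' \<union> visible y = S \<union> visible y" by (auto simp: S'_def)
        then show ?thesis using y True new dist_triangle[of x0 y x]
          by (intro exI[of _ y]) (auto simp: S'_def dist_commute)
      next
        case not_sub: False
        have "\<not> visible y \<subseteq> visible x" using y by (auto simp: S'_def)
        then obtain k where k: "measure lborel (visible y - visible x) \<le> k"
          "\<And>\<eta>. sweep_cost (half_angle x) (\<eta> + k) \<le> dist x y + sweep_cost (half_angle y) \<eta>"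
          using visible_step[OF x y(1) _ not_sub] by blast
        \<comment> \<open>What is missing after \<open>x\<close> exceeds what is missing after
          \<open>y\<close> by at most \<open>k\<close>.\<close>
        have "measure lborel (S' \<union> visible y) = measure lborel (S' \<union> (visible y - visible x))"
          by (rule arg_cong[of _ _ "measure lborel"]) (auto simp: S'_def)
        also have "\<dots> \<le> measure lborel S' + measure lborel (visible y - visible x)"
          using S' by (intro measure_Un_le) auto
        finally have "\<mu> - measure lborel S' \<le> (\<mu> - measure lborel (S' \<union> visible y)) + k"
          using k(1) by linarith
        then have "sweep_cost (half_angle x) (\<mu> - measure lborel S') \<le> path_length (x # xs)"
          using k(2)[of "\<mu> - measure lborel (S' \<union> visible y)"] y(3)
            sweep_cost_mono[OF half_angle_bounds(1,2)[OF x]] by (meson order_trans)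
        then show ?thesis using x new by (intro exI[of _ x]) (auto simp: S'_def)
      qed
    qed
  qed
qed

text \<open>The leg from the origin to the remaining viewpoint \<open>y\<close> costs
  \<open>norm y = 1 / cos a\<close>, and \<open>y\<close> sees at most \<open>2 * a\<close>, which
  leaves \<open>\<mu> - 2 * a\<close> to the sweep.\<close>

lemma path_length_from_origin_ge:
  assumes "0 < \<mu>" "\<mu> \<le> measure lborel (\<Union>x\<in>set xs. visible x)"
  obtains a where "0 \<le> a" "a < pi / 2" "1 / cos a + sweep_cost a (\<mu> - 2 * a) \<le> path_length (0 # xs)"
proof -
  obtain y where y: "1 \<le> norm y"
    "norm y + sweep_cost (half_angle y) (\<mu> - measure lborel (visible y)) \<le> path_length (0 # xs)"
    using path_length_ge_sweep[of "{}" \<mu> xs 0] assms by auto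
  note h = half_angle_bounds[OF y(1)]
  have "sweep_cost (half_angle y) (\<mu> - 2 * half_angle y)
      \<le> sweep_cost (half_angle y) (\<mu> - measure lborel (visible y))"
    using measure_visible_le[OF y(1)] by (intro sweep_cost_mono h) auto
  then show thesis using that[OF h(1,2)] y h by simp
qed

section \<open>The lower bound for the cost\<close>

lemma path_length_samples_le:
  fixes f :: "real \<Rightarrow> 'a::metric_space"
  assumes "L-lipschitz_on {s..} f" "sorted (s # ss)" "\<And>u. u \<in> set (s # ss) \<Longrightarrow> u \<le> T"
  shows "path_length (map f (s # ss)) \<le> L * (T - s)"
  using assms
proof (induction ss arbitrary: s)
  case Nil
  then show ?case using lipschitz_on_nonneg[OF Nil(1)] by simp
next
  case (Cons u ss)
  have su: "s \<le> u" using Cons.prems(2) by simp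
  have "L-lipschitz_on {u..} f"
    by (rule lipschitz_on_subset[OF Cons.prems(1)]) (use su in auto)
  then have "path_length (map f (u # ss)) \<le> L * (T - u)"
    by (rule Cons.IH) (use Cons.prems in auto)
  moreover have "dist (f s) (f u) \<le> L * (u - s)"
    using lipschitz_onD[OF Cons.prems(1), of s u] su by (simp add: dist_real_def)
  ultimately show ?case by (simp add: algebra_simps)
qed

definition opt_cost :: "nat \<Rightarrow> real" where
  "opt_cost n = (if n \<le> 2 then 1 + sqrt 3 + 2 * pi / real n - 5 * pi / 6 else 1 / cos (pi / real n))"

lemma opt_cost_le_path_length:
  assumes "1 \<le> n" "2 * pi / n \<le> measure lborel (\<Union>x\<in>set xs. visible x)"
  shows "opt_cost n \<le> path_length (0 # xs)"
proof -
  have "0 < 2 * pi / real n" using assms by simp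
  then obtain a where a: "0 \<le> a" "a < pi / 2"
    "1 / cos a + sweep_cost a (2 * pi / n - 2 * a) \<le> path_length (0 # xs)"
    using path_length_from_origin_ge assms(2) by blast
  consider "n = 1" | "n = 2" | "3 \<le> n" using assms(1) by linarith
  then have "opt_cost n \<le> 1 / cos a + sweep_cost a (2 * pi / n - 2 * a)"
  proof cases
    case 1
    then show ?thesis using sec_plus_sweep_cost_ge_wide[OF a(1,2), of "2 * pi"] by (simp add: opt_cost_def)
  next
    case 2
    then show ?thesis using sec_plus_sweep_cost_ge_wide[OF a(1,2), of pi] by (simp add: opt_cost_def)
  next
    case 3
    have "pi / n \<le> pi / 3" using 3 by (intro divide_left_mono) auto
    then show ?thesis
      using sec_plus_sweep_cost_ge_narrow[OF a(1,2), of "pi / n"] 3 by (simp add: opt_cost_def)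
  qed
  then show ?thesis using a(3) by linarith
qed

text \<open>If all points were seen before some \<open>T < opt_cost n\<close>, finitely many scaled
  positions would cover the circle, and one agent would see \<open>2 * pi / n\<close> along a
  polygon shorter than \<open>opt_cost n\<close>.\<close>

lemma opt_cost_le_cost:
  assumes n: "1 \<le> n" and feas: "feasible n x"
  shows "ereal (opt_cost n) \<le> cost n x"
proof (rule ccontr)
  assume "\<not> ereal (opt_cost n) \<le> cost n x"
  then have "cost n x < ereal (opt_cost n)" by simp
  then obtain T where T: "cost n x < ereal T" "T < opt_cost n"
    using ereal_dense2 by (metis ereal_less(4) less_ereal.simps(1) not_less)
  have lip: "x i 0 = 0" "1-lipschitz_on {0..} (x i)" if "i < n" for i
    using feas that by (auto simp: feasible_def trajectories_def)
  have seen: "\<exists>i s. i < n \<and> 0 \<le> s \<and> s < T \<and> 1 \<le> x i s \<bullet> bdpt \<theta>" if \<theta>: "\<theta> \<in> {0..2 * pi}" for \<theta>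
  proof -
    obtain s where s: "s \<in> insp_times n x (bdpt \<theta>)" "insp n x (bdpt \<theta>) = ereal s"
      using insp_first_time[OF feas \<theta>] by blast
    have "ereal s \<le> cost n x" unfolding cost_def s(2)[symmetric] using \<theta> by (rule SUP_upper)
    then have "s < T" using T(1) by (metis le_less_trans less_ereal.simps(1))
    then show ?thesis using s(1) by (auto simp: insp_times_def inspects_bdpt_iff)
  qed
  from seen[of 0] have "0 < T" by auto
  \<comment> \<open>Scaling the trajectories by a factor slightly above 1 makes the sets seen open, so that
    compactness leaves finitely many positions.\<close>
  define \<kappa> where "\<kappa> = (1 + opt_cost n / T) / 2"
  have \<kappa>: "1 < \<kappa>" "\<kappa> * T < opt_cost n" using \<open>0 < T\<close> T(2) by (auto simp: \<kappa>_def field_simps)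
  define U where "U = (\<lambda>(i, s). {t. 1 < (\<kappa> *\<^sub>R x i s) \<bullet> bdpt t})"
  have open_U: "open (U c)" for c
    unfolding U_def
    by (cases c) (auto intro!: open_Collect_less continuous_intros continuous_on_bdpt)
  have cover: "{0..2 * pi} \<subseteq> (\<Union>c\<in>{..<n} \<times> {0..T}. U c)"
  proof
    fix \<theta> assume "\<theta> \<in> {0..2 * pi}"
    then obtain i s where hit: "i < n" "0 \<le> s" "s < T" "1 \<le> x i s \<bullet> bdpt \<theta>" using seen by blast
    have "\<kappa> * 1 \<le> \<kappa> * (x i s \<bullet> bdpt \<theta>)" using hit \<kappa> by (intro mult_left_mono) auto
    then have "1 < \<kappa> * (x i s \<bullet> bdpt \<theta>)" using \<kappa> by linarith
    then have "\<theta> \<in> U (i, s)" by (simp add: U_def)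
    moreover have "(i, s) \<in> {..<n} \<times> {0..T}" using hit by simp
    ultimately show "\<theta> \<in> (\<Union>c\<in>{..<n} \<times> {0..T}. U c)" by (rule UN_I[rotated])
  qed
  obtain C where C: "C \<subseteq> {..<n} \<times> {0..T}" "finite C" "{0..2 * pi} \<subseteq> (\<Union>c\<in>C. U c)"
    by (rule compactE_image[OF compact_Icc open_U cover])
  \<comment> \<open>Sorted, so that the polygon visits the positions in temporal order.\<close>
  define times where "times i = sorted_list_of_set {s. (i, s) \<in> C}" for i
  have fin: "finite {s. (i, s) \<in> C}" for i
    by (rule finite_subset[of _ "snd ` C"]) (use C(2) in force)+
  have set_times: "set (times i) = {s. (i, s) \<in> C}" for i
    using fin by (simp add: times_def)
  define A where "A i = (\<Union>y\<in>set (map (\<lambda>s. \<kappa> *\<^sub>R x i s) (times i)). visible y)" for i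
  have A_sets: "A i \<in> sets lborel" for i by (auto simp: A_def)
  have "{0..<2 * pi} \<subseteq> (\<Union>i<n. A i)"
  proof
    fix \<theta> assume \<theta>: "\<theta> \<in> {0..<2 * pi}"
    then have "\<theta> \<in> (\<Union>c\<in>C. U c)" using subsetD[OF C(3), of \<theta>] by simp
    then obtain i s where hit: "(i, s) \<in> C" "1 < (\<kappa> *\<^sub>R x i s) \<bullet> bdpt \<theta>" by (auto simp: U_def)
    then have "\<theta> \<in> visible (\<kappa> *\<^sub>R x i s)" using \<theta> by (simp add: visible_def)
    then show "\<theta> \<in> (\<Union>i<n. A i)" using hit(1) C(1) by (auto simp: A_def set_times)
  qed
  moreover have "(\<Union>i<n. A i) \<subseteq> {0..<2 * pi}"
    using visible_subset by (force simp: A_def)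
  ultimately have whole: "(\<Union>i<n. A i) = {0..<2 * pi}" by blast
  have "2 * pi = measure lborel {0..<2 * pi}" by simp
  also have "\<dots> = measure lborel (\<Union>i<n. A i)" unfolding whole ..
  also have "\<dots> \<le> (\<Sum>i<n. measure lborel (A i))"
    using A_sets by (intro measure_UNION_le) auto
  finally have total: "2 * pi \<le> (\<Sum>i<n. measure lborel (A i))" .
  have "\<exists>i<n. 2 * pi / n \<le> measure lborel (A i)"
  proof (rule ccontr)
    assume neg: "\<not> ?thesis"
    have "(\<Sum>i<n. measure lborel (A i)) < (\<Sum>i<n. 2 * pi / n)"
    proof (rule sum_strict_mono)
      have "0 \<in> {..<n}" using n by simp
      then show "{..<n} \<noteq> {}" by blast
      show "measure lborel (A i) < 2 * pi / n" if "i \<in> {..<n}" for i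
        using neg that unfolding lessThan_iff not_le[symmetric] by blast
    qed simp
    also have "\<dots> = 2 * pi" using n by simp
    finally show False using total by simp
  qed
  then obtain i where i: "i < n" "2 * pi / n \<le> measure lborel (A i)" by blast
  have lip_i: "\<kappa>-lipschitz_on {0..} (\<lambda>s. \<kappa> *\<^sub>R x i s)"
    using lipschitz_on_cmult[OF lip(2)[OF i(1)], of \<kappa>] \<kappa> by simp
  have range: "0 \<le> s" "s \<le> T" if "s \<in> set (times i)" for s
    using that C(1) by (auto simp: set_times)
  have "opt_cost n \<le> path_length (0 # map (\<lambda>s. \<kappa> *\<^sub>R x i s) (times i))"
    using i(2) by (intro opt_cost_le_path_length n) (simp add: A_def)
  also have "\<dots> = path_length (map (\<lambda>s. \<kappa> *\<^sub>R x i s) (0 # times i))"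
    using lip(1)[OF i(1)] by simp
  also have "\<dots> \<le> \<kappa> * (T - 0)"
    using range \<open>0 < T\<close>
    by (intro path_length_samples_le[OF lip_i]) (auto simp: times_def)
  finally show False using \<kappa> by simp
qed

section \<open>Optimal trajectories\<close>

lemma cost_le:
  assumes "trajectories n x"
    and "\<And>\<theta>. \<theta> \<in> {0..2 * pi} \<Longrightarrow> \<exists>i<n. \<exists>s. 0 \<le> s \<and> s \<le> c \<and> 1 \<le> x i s \<bullet> bdpt \<theta>"
  shows "feasible n x" "cost n x \<le> ereal c"
proof -
  have seen: "\<exists>s\<in>insp_times n x (bdpt \<theta>). s \<le> c" if "\<theta> \<in> {0..2 * pi}" for \<theta>
    using assms(2)[OF that] by (auto simp: insp_times_def inspects_bdpt_iff)
  then show "feasible n x" using assms(1) unfolding feasible_def by blast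
  show "cost n x \<le> ereal c"
    unfolding cost_def
  proof (rule SUP_least)
    fix \<theta> assume "\<theta> \<in> {0..2 * pi}"
    then obtain s where s: "s \<in> insp_times n x (bdpt \<theta>)" "s \<le> c" using seen by blast
    have "insp n x (bdpt \<theta>) \<le> ereal s" unfolding insp_def using s(1) by (rule INF_lower)
    then show "insp n x (bdpt \<theta>) \<le> ereal c" using s(2) by (meson ereal_less_eq(3) order_trans)
  qed
qed

lemma lipschitz_on_ray:
  assumes "norm v = 1"
  shows "1-lipschitz_on S (\<lambda>s. p + (s - t) *\<^sub>R v)"
proof (rule lipschitz_onI)
  fix u w
  have "dist (p + (u - t) *\<^sub>R v) (p + (w - t) *\<^sub>R v) = norm ((u - w) *\<^sub>R v)"
    by (simp add: dist_norm algebra_simps)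
  then show "dist (p + (u - t) *\<^sub>R v) (p + (w - t) *\<^sub>R v) \<le> 1 * dist u w"
    using assms by (simp add: dist_real_def)
qed simp

text \<open>A chord has length \<open>2 * \<bar>sin ((u - w) / 2)\<bar>\<close>, at most the length
  of its arc.\<close>

lemma lipschitz_on_bdpt: "1-lipschitz_on S (\<lambda>s. bdpt (s + t))"
proof (rule lipschitz_onI)
  fix u w :: real
  have "cos (w - u) = cos (u - w)" by (metis cos_minus minus_diff_eq)
  then have "(dist (bdpt (u + t)) (bdpt (w + t)))\<^sup>2 = 2 - 2 * cos (u - w)"
    by (simp add: dist_norm power2_norm_eq_inner inner_diff_left inner_diff_right inner_bdpt_bdpt)
  also have "\<dots> = (2 * sin ((u - w) / 2))\<^sup>2"
    using cos_double_sin[of "(u - w) / 2"]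
    by (simp only: mult_2[symmetric] nonzero_mult_div_cancel_left times_divide_eq_right
        power_mult_distrib) (simp add: field_simps)
  also have "\<dots> \<le> (u - w)\<^sup>2"
    using abs_sin_x_le_abs_x[of "(u - w) / 2"] by (intro abs_le_square_iff[THEN iffD1]) (simp add: abs_mult)
  finally show "dist (bdpt (u + t)) (bdpt (w + t)) \<le> 1 * dist u w"
    by (simp add: dist_real_def abs_le_square_iff[symmetric])
qed simp

lemma opt_cost_attained_many:
  assumes n: "3 \<le> n"
  shows "\<exists>x. feasible n x \<and> cost n x \<le> ereal (opt_cost n)"
proof -
  \<comment> \<open>The middle of the \<open>i\<close>-th of \<open>n\<close> equal arcs; walking
    straight towards it, an agent sees the whole arc at distance
    \<open>1 / cos (pi / n)\<close>.\<close>
  define c where "c i = (2 * real i + 1) * pi / n" for i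
  define x where "x i s = 0 + (s - 0) *\<^sub>R bdpt (c i)" for i :: nat and s :: real
  have traj: "trajectories n x"
    unfolding trajectories_def
  proof (intro allI impI conjI)
    show "1-lipschitz_on {0..} (x i)" for i
      unfolding x_def[abs_def] by (rule lipschitz_on_ray[OF norm_bdpt])
  qed (simp add: x_def)
  have small: "pi / n \<le> pi / 3" using n by (intro divide_left_mono) auto
  have pos: "0 < pi / n" using n by simp
  have "pi / n < pi / 2" using small pi_gt_zero by linarith
  then have cpos: "0 < cos (pi / n)" using pos by (intro cos_gt_zero) auto
  have "\<exists>i<n. \<exists>s. 0 \<le> s \<and> s \<le> opt_cost n \<and> 1 \<le> x i s \<bullet> bdpt \<theta>" if \<theta>: "\<theta> \<in> {0..2 * pi}" for \<theta>
  proof -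
    have "\<exists>i<n. \<bar>c i - \<theta>\<bar> \<le> pi / n"
    \<comment> \<open>At \<open>2 * pi\<close> the index \<open>\<lfloor>z\<rfloor>\<close> would be
      \<open>n\<close>, one too large; the last agent covers this endpoint.\<close>
    proof (cases "\<theta> = 2 * pi")
      case True
      then show ?thesis using n
        by (intro exI[of _ "n - 1"]) (auto simp: c_def of_nat_diff field_simps)
    next
      case False
      define z where "z = \<theta> * n / (2 * pi)"
      have z: "0 \<le> z" "z < n" using \<theta> False n by (auto simp: z_def field_simps)
      define i where "i = nat \<lfloor>z\<rfloor>"
      have i: "real i \<le> z" "z < real i + 1" using z(1) by (auto simp: i_def)
      then have "i < n" using z(2) by linarith
      have "\<theta> = z * (2 * pi / n)" using n by (simp add: z_def)
      then have "c i - \<theta> = (real i + 1 / 2 - z) * (2 * pi / n)" using n by (simp add: c_def field_simps)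
      then have "\<bar>c i - \<theta>\<bar> = \<bar>real i + 1 / 2 - z\<bar> * (2 * pi / n)" by (simp add: abs_mult)
      also have "\<dots> \<le> 1 / 2 * (2 * pi / n)" using i by (intro mult_right_mono) (linarith, simp)
      finally show ?thesis using \<open>i < n\<close> by auto
    qed
    then obtain i where i: "i < n" "\<bar>c i - \<theta>\<bar> \<le> pi / n" by blast
    have "cos (pi / n) \<le> cos \<bar>c i - \<theta>\<bar>" using i small pi_gt_zero
      by (intro cos_monotone_0_pi_le) linarith+
    then have "1 \<le> x i (1 / cos (pi / n)) \<bullet> bdpt \<theta>"
      using cpos by (simp add: x_def inner_bdpt_bdpt)
    then show ?thesis using i(1) cpos n
      by (intro exI[of _ i] conjI exI[of _ "1 / cos (pi / n)"]) (auto simp: opt_cost_def)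
  qed
  then show ?thesis using cost_le[OF traj] by blast
qed

text \<open>The path runs to the intersection of the tangents at angles \<open>p\<close> and \<open>p + pi / 3\<close>, then along the
  latter tangent to the circle, follows the circle up to angle \<open>p + b\<close>, and leaves along the
  tangent there; one time unit later it has seen up to angle \<open>p + b + pi / 2\<close>.\<close>

definition few_agents_path :: "real \<Rightarrow> real \<Rightarrow> real \<Rightarrow> real ^ 2" where
  "few_agents_path p b s =
     (if s \<le> 2 / sqrt 3 then 0 + (s - 0) *\<^sub>R bdpt (p + pi / 6)
      else if s \<le> sqrt 3 then bdpt (p + pi / 3) + (s - sqrt 3) *\<^sub>R bdpt (p + pi / 3 + pi / 2)
      else if s \<le> sqrt 3 + b - pi / 3 then bdpt (s + (p + pi / 3 - sqrt 3))
      else bdpt (p + b) + (s - (sqrt 3 + b - pi / 3)) *\<^sub>R bdpt (p + b + pi / 2))"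

text \<open>The four unit-speed pieces fit together. The tangents meet at distance
  \<open>2 / sqrt 3 = 1 / cos (pi / 6)\<close>; a further \<open>tan (pi / 6)\<close> reaches the
  circle at time \<open>sqrt 3\<close>.\<close>

lemma lipschitz_on_few_agents_path:
  assumes b: "pi / 3 \<le> b"
  shows "1-lipschitz_on {0..} (few_agents_path p b)"
proof -
  have s3: "2 / sqrt 3 \<le> sqrt 3" by (simp add: field_simps)
  let ?f1 = "\<lambda>s. 0 + (s - 0) *\<^sub>R bdpt (p + pi / 6)"
  let ?f2 = "\<lambda>s. bdpt (p + pi / 3) + (s - sqrt 3) *\<^sub>R bdpt (p + pi / 3 + pi / 2)"
  let ?f3 = "\<lambda>s. bdpt (s + (p + pi / 3 - sqrt 3))"
  let ?f4 = "\<lambda>s. bdpt (p + b) + (s - (sqrt 3 + b - pi / 3)) *\<^sub>R bdpt (p + b + pi / 2)"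
  let ?t3 = "sqrt 3 + b - pi / 3"
  have j1: "?f1 (2 / sqrt 3) = ?f2 (2 / sqrt 3)"
  proof -
    have c: "cos (p + pi / 6) * 2 / sqrt 3 = cos (p + pi / 3) - (2 / sqrt 3 - sqrt 3) * sin (p + pi / 3)"
      by (simp only: cos_add sin_add sin_30 cos_30 sin_60 cos_60) (simp add: field_simps)
    have d: "sin (p + pi / 6) * 2 / sqrt 3 = sin (p + pi / 3) + (2 / sqrt 3 - sqrt 3) * cos (p + pi / 3)"
      by (simp only: cos_add sin_add sin_30 cos_30 sin_60 cos_60) (simp add: field_simps)
    have "bdpt (p + pi / 3 + pi / 2) = vector [- sin (p + pi / 3), cos (p + pi / 3)]"
      unfolding bdpt_def cos_add[of "p + pi / 3" "pi / 2"] sin_add[of "p + pi / 3" "pi / 2"] by simp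
    then show ?thesis
      using c d by (simp add: vec_eq_iff forall_2 bdpt_def mult.commute)
  qed
  have L: "1-lipschitz_on {0..c}
      (\<lambda>s. if s \<le> 2 / sqrt 3 then ?f1 s else if s \<le> sqrt 3 then ?f2 s else if s \<le> ?t3 then ?f3 s else ?f4 s)"
    if c: "?t3 \<le> c" for c
  proof (intro lipschitz_on_concat lipschitz_on_ray norm_bdpt lipschitz_on_bdpt)
    show "?f1 (2 / sqrt 3) = (if 2 / sqrt 3 \<le> sqrt 3 then ?f2 (2 / sqrt 3)
      else if 2 / sqrt 3 \<le> ?t3 then ?f3 (2 / sqrt 3) else ?f4 (2 / sqrt 3))"
      using j1 s3 by simp
  qed (use b s3 in \<open>auto simp: algebra_simps\<close>)
  show ?thesis
  proof (rule lipschitz_onI)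
    fix u w :: real assume "u \<in> {0..}" "w \<in> {0..}"
    then show "dist (few_agents_path p b u) (few_agents_path p b w) \<le> 1 * dist u w"
      using lipschitz_onD[OF L[of "max ?t3 (max u w)"], of u w] by (simp add: few_agents_path_def)
  qed simp
qed

text \<open>Angles up to \<open>pi / 3\<close> are seen from the intersection of the tangents, those
  up to \<open>b\<close> from the circle itself, the rest from the end point, because
  \<open>cos e + sin e \<ge> 1\<close> on a quarter turn.\<close>

lemma few_agents_path_sees:
  assumes b: "pi / 3 \<le> b" and t: "0 \<le> t" "t \<le> b + pi / 2"
  shows "\<exists>s. 0 \<le> s \<and> s \<le> sqrt 3 + b - pi / 3 + 1 \<and> 1 \<le> few_agents_path p b s \<bullet> bdpt (p + t)"
proof -
  have s3: "2 / sqrt 3 \<le> sqrt 3" by (simp add: field_simps)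
  consider "t \<le> pi / 3" | "pi / 3 < t" "t \<le> b" | "b < t" by linarith
  then show ?thesis
  proof cases
    case 1
    have "cos (pi / 6) \<le> cos \<bar>pi / 6 - t\<bar>"
      using 1 t by (intro cos_monotone_0_pi_le) linarith+
    then have "1 \<le> few_agents_path p b (2 / sqrt 3) \<bullet> bdpt (p + t)"
      unfolding cos_abs_real by (simp add: few_agents_path_def inner_bdpt_bdpt cos_30 pos_le_divide_eq)
    then show ?thesis using s3 b by (intro exI[of _ "2 / sqrt 3"]) auto
  next
    case 2
    have "sqrt 3 < sqrt 3 + t - pi / 3" using 2 by simp
    then have "few_agents_path p b (sqrt 3 + t - pi / 3) = bdpt (p + t)"
      using 2 s3 by (simp add: few_agents_path_def algebra_simps)
    moreover have "0 \<le> sqrt 3 + t - pi / 3" using 2 real_sqrt_ge_zero[of 3] by linarith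
    ultimately show ?thesis
      using 2 by (intro exI[of _ "sqrt 3 + t - pi / 3"]) (auto simp: inner_bdpt_bdpt)
  next
    case 3
    define e where "e = t - b"
    have e: "0 \<le> e" "e \<le> pi / 2" using 3 t by (auto simp: e_def)
    have sc: "0 \<le> sin e" "0 \<le> cos e" using e by (auto intro!: sin_ge_zero cos_ge_zero)
    then have "1\<^sup>2 \<le> (cos e + sin e)\<^sup>2"
      using sin_cos_squared_add[of e] by (simp add: power2_sum)
    then have "1 \<le> cos e + sin e"
      by (rule power2_le_imp_le) (intro add_nonneg_nonneg sc)
    moreover have "few_agents_path p b (sqrt 3 + b - pi / 3 + 1) = bdpt (p + b) + bdpt (p + b + pi / 2)"
      using b s3 by (simp add: few_agents_path_def)
    moreover have "bdpt (p + b) \<bullet> bdpt (p + t) = cos e" "bdpt (p + b + pi / 2) \<bullet> bdpt (p + t) = sin e"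
    proof -
      have "p + b - (p + t) = - e" "p + b + pi / 2 - (p + t) = pi / 2 - e" by (auto simp: e_def)
      then show "bdpt (p + b) \<bullet> bdpt (p + t) = cos e" "bdpt (p + b + pi / 2) \<bullet> bdpt (p + t) = sin e"
        unfolding inner_bdpt_bdpt by (simp_all only:) (simp_all add: cos_diff)
    qed
    moreover have "0 \<le> sqrt 3 + b - pi / 3 + 1" using b real_sqrt_ge_zero[of 3] by linarith
    ultimately show ?thesis
      by (intro exI[of _ "sqrt 3 + b - pi / 3 + 1"]) (auto simp: inner_add_left)
  qed
qed

lemma opt_cost_attained_few:
  assumes n: "1 \<le> n" "n \<le> 2"
  shows "\<exists>x. feasible n x \<and> cost n x \<le> ereal (opt_cost n)"
proof -
  \<comment> \<open>Each agent takes an arc of length \<open>2 * pi / n\<close>; the final tangent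
    leg reveals its last \<open>pi / 2\<close>.\<close>
  define b where "b = 2 * pi / n - pi / 2"
  define x where "x i = few_agents_path (2 * pi * real i / n) b" for i :: nat
  have n12: "n = 1 \<or> n = 2" using n by linarith
  have b: "pi / 3 \<le> b" using n12 by (auto simp: b_def)
  have end_time: "sqrt 3 + b - pi / 3 + 1 = opt_cost n" using n by (simp add: opt_cost_def b_def)
  have traj: "trajectories n x"
    using lipschitz_on_few_agents_path[OF b] by (auto simp: trajectories_def x_def few_agents_path_def)
  have "\<exists>i<n. \<exists>s. 0 \<le> s \<and> s \<le> opt_cost n \<and> 1 \<le> x i s \<bullet> bdpt \<theta>" if \<theta>: "\<theta> \<in> {0..2 * pi}" for \<theta>
  proof -
    have "\<exists>i<n. 0 \<le> \<theta> - 2 * pi * real i / n \<and> \<theta> - 2 * pi * real i / n \<le> 2 * pi / n"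
    proof (cases "n = 1 \<or> \<theta> \<le> pi")
      case True
      then show ?thesis using n12 \<theta> by (intro exI[of _ 0]) auto
    next
      case False
      then show ?thesis using n12 \<theta> by (intro exI[of _ 1]) auto
    qed
    then obtain i where i: "i < n" "0 \<le> \<theta> - 2 * pi * real i / n" "\<theta> - 2 * pi * real i / n \<le> 2 * pi / n"
      by blast
    then show ?thesis
      using few_agents_path_sees[OF b i(2), of "2 * pi * real i / n"]
      unfolding end_time by (auto simp: x_def b_def)
  qed
  then show ?thesis using cost_le[OF traj] by blast
qed

theorem theorem2:
  fixes n :: nat
  assumes "n \<ge> 1"
  shows "is_optimal_cost n
           (ereal (if n \<le> 2 then 1 + sqrt 3 + 2 * pi / real n - 5 * pi / 6
                   else 1 / cos (pi / real n)))"
proof -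
  obtain x where x: "feasible n x" "cost n x \<le> ereal (opt_cost n)"
    using opt_cost_attained_many[of n] opt_cost_attained_few[of n] assms by (cases "n \<le> 2") auto
  have "cost n x = ereal (opt_cost n)"
    using x opt_cost_le_cost[OF assms x(1)] by (intro antisym)
  then have "is_optimal_cost n (ereal (opt_cost n))"
    unfolding is_optimal_cost_def using x(1) opt_cost_le_cost[OF assms] by blast
  then show ?thesis by (simp only: opt_cost_def)
qed

end
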